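(* The additive semigroup $\mathbb{N}$ of nonnegative integers is prime in the full subcategory of $\mathbf{Semigp}$ whose objects are the monoids, and, more generally, in the full subcategory of $\mathbf{Semigp}$ whose objects are the semigroups in which every element is a product (i.e., semigroups $S$ such that every $x\in S$ can be written $x=yz$ with $y,z\in S$).
   Context: "Semigroup" means nonempty semigroup; $\mathbf{Semigp}$ is the category of all such semigroups with semigroup homomorphisms. In the full subcategory of monoids, morphisms are arbitrary semigroup homomorphisms. In a category $\mathcal{C}$ with finite direct products, $Y$ admits $X$ as a direct factor if $Y\cong X\times Z$ for some object $Z$ of $\mathcal{C}$. An object $X$ of $\mathcal{C}$ other than the final object (here, the one-element semigroup) is called prime in $\mathcal{C}$ (in the sense of Tarski) if, whenever an object $Y$ of $\mathcal{C}$ admits $X$ as a direct factor, and $Y=Y_0\times Y_1$ is another direct product decomposition of $Y$ in $\mathcal{C}$, then one of $Y_0,Y_1$ admits $X$ as a direct factor. *)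

theory Defs
  imports "HOL-Algebra.Group"
begin

text \<open>
  Semigroups are represented by the monoid records of HOL-Algebra. Only the fields
  \<^const>\<open>carrier\<close> and \<^const>\<open>mult\<close> of a semigroup carry meaning; the field
  \<^const>\<open>one\<close> is arbitrary. The notions \<^const>\<open>hom\<close>, \<^const>\<open>iso\<close> and
  \<^const>\<open>is_iso\<close> of HOL-Algebra ignore this field, so they are semigroup homomorphisms
  and isomorphisms, also between monoids.
\<close>

locale semigp =
  fixes G (structure)
  assumes nonempty: "carrier G \<noteq> {}"
    and closed: "\<lbrakk>x \<in> carrier G; y \<in> carrier G\<rbrakk> \<Longrightarrow> x \<otimes> y \<in> carrier G"
    and assoc: "\<lbrakk>x \<in> carrier G; y \<in> carrier G; z \<in> carrier G\<rbrakk>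
      \<Longrightarrow> (x \<otimes> y) \<otimes> z = x \<otimes> (y \<otimes> z)"

locale semigp_of_products = semigp +
  assumes factors: "x \<in> carrier G \<Longrightarrow> \<exists>y\<in>carrier G. \<exists>z\<in>carrier G. x = y \<otimes> z"

text \<open>
  A full subcategory of the category of semigroups, closed under isomorphism, is given by a
  predicate \<open>C\<close> on its objects, whose elements are drawn from a type \<open>'u\<close>. Both subcategories
  of interest, that of monoids and that of semigroups in which every element is a product, are
  closed under finite direct products of semigroups, so these products are also the products
  in the subcategory.

  In \<open>Y \<cong> X \<times> Z\<close> and \<open>Y \<cong> Y\<^sub>0 \<times> Y\<^sub>1\<close> with nonempty factors, all factors embed (as sets) in
  \<open>Y\<close>. Hence using one type \<open>'u\<close> for \<open>Y\<close>, \<open>Z\<close>, \<open>Y\<^sub>0\<close>, \<open>Y\<^sub>1\<close> is no restriction when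
  \<open>'u\<close> is arbitrary. The candidate \<open>X\<close> may live in another type; that it is an object of the
  subcategory has to be stated separately.
\<close>

definition direct_factor ::
    "('u monoid \<Rightarrow> bool) \<Rightarrow> 'x monoid \<Rightarrow> 'u monoid \<Rightarrow> bool" where
  "direct_factor C X Y \<longleftrightarrow> (\<exists>Z. C Z \<and> Y \<cong> X \<times>\<times> Z)"

definition prime_in :: "('u monoid \<Rightarrow> bool) \<Rightarrow> 'x monoid \<Rightarrow> bool" where
  "prime_in C X \<longleftrightarrow>
    \<not> (\<exists>e. carrier X = {e}) \<and>
    (\<forall>Y Y0 Y1. C Y \<and> C Y0 \<and> C Y1 \<and> direct_factor C X Y \<and> Y \<cong> Y0 \<times>\<times> Y1 \<longrightarrow>
      direct_factor C X Y0 \<or> direct_factor C X Y1)"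

definition nat_add :: "nat monoid" where
  "nat_add = \<lparr>carrier = UNIV, mult = (+), one = 0\<rparr>"

end

theory Submission
  imports Defs
begin

text \<open>
  A decomposition \<open>S \<cong> \<nat> \<times> Z\<close> is the same thing as a pair \<open>(g, A)\<close> on \<open>S\<close> itself: the projection
  \<open>g\<close> to \<open>\<nat>\<close>, a homomorphism, and the shift \<open>A\<close> that adds \<open>1\<close> to the first coordinate, an
  injective map with \<open>A (x y) = (A x) y = x (A y)\<close> and \<open>g (A x) = g x + 1\<close> whose range contains
  every element of positive degree \<open>g\<close>. The complement \<open>Z\<close> is recovered as the part of degree
  \<open>0\<close>, and every element is \<open>A\<^sup>n z\<close> for exactly one \<open>n\<close> and one such \<open>z\<close>
  (\<open>iso_nat_times_degree_zero\<close>). This is the locale \<open>nat_shift\<close>.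

  Now let \<open>(f, T)\<close> be such a pair on \<open>Y\<^sub>0 \<times> Y\<^sub>1\<close>. Both components split along the product.
  Every homomorphism \<open>f\<close> to \<open>\<nat>\<close> from a product of semigroups has the form
  \<open>f (x, y) = g x + h y\<close> with homomorphisms \<open>g\<close> and \<open>h\<close> to \<open>\<nat>\<close>, even though there are no identity
  elements along which \<open>f\<close> could be restricted (\<open>hom_to_nat_splits\<close>). The shift has the form
  \<open>T (x, y) = (A x, B y)\<close>; here it matters that every element is a product
  (\<open>translation_splits\<close>). Raising \<open>f\<close> by \<open>1\<close> then means
  \<open>g (A x) + h (B y) = g x + h y + 1\<close> for all \<open>x\<close> and \<open>y\<close>, and since neither \<open>g\<close> nor \<open>h\<close> can drop
  below its minimum, one of \<open>A\<close>, \<open>B\<close> raises the degree by \<open>1\<close> and the other one keeps it. The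
  factor on which the degree is raised inherits the remaining properties from \<open>(f, T)\<close>, and so
  splits off a copy of \<open>\<nat>\<close>.

  The complement produced in this way is a part of degree \<open>0\<close>. It contains the identity element if
  there is one, and with every product all its factors, which gives the result in both
  subcategories (\<open>prime_in_nat_addI\<close>).
\<close>

section \<open>Copies of the natural numbers as direct factors\<close>

text \<open>
  The maps \<open>A\<close> are what multiplication by a central element becomes when the semigroup has no
  identity element.
\<close>

definition translation :: "'a monoid \<Rightarrow> ('a \<Rightarrow> 'a) \<Rightarrow> bool" where
  "translation S A \<longleftrightarrow> A \<in> carrier S \<rightarrow> carrier S \<and>
    (\<forall>x\<in>carrier S. \<forall>y\<in>carrier S.
      A (x \<otimes>\<^bsub>S\<^esub> y) = A x \<otimes>\<^bsub>S\<^esub> y \<and> A (x \<otimes>\<^bsub>S\<^esub> y) = x \<otimes>\<^bsub>S\<^esub> A y)"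

locale nat_shift = semigp S for S :: "'a monoid" (structure) +
  fixes g :: "'a \<Rightarrow> nat" and A :: "'a \<Rightarrow> 'a"
  assumes degree_hom: "g \<in> hom S nat_add"
    and translation: "translation S A"
    and inj: "inj_on A (carrier S)"
    and degree_shift: "x \<in> carrier S \<Longrightarrow> g (A x) = g x + 1"
    and shift_onto: "\<lbrakk>x \<in> carrier S; g x > 0\<rbrakk> \<Longrightarrow> x \<in> A ` carrier S"

definition degree_zero :: "'a monoid \<Rightarrow> ('a \<Rightarrow> nat) \<Rightarrow> 'a monoid" where
  "degree_zero S g = S\<lparr>carrier := {x \<in> carrier S. g x = 0}\<rparr>"

lemma hom_nat_add_iff:
  "g \<in> hom S nat_add \<longleftrightarrow>
    (\<forall>x\<in>carrier S. \<forall>y\<in>carrier S. g (x \<otimes>\<^bsub>S\<^esub> y) = g x + g y)"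
  by (auto simp: hom_def nat_add_def)

context nat_shift
begin

lemma shift_closed [simp]: "x \<in> carrier S \<Longrightarrow> A x \<in> carrier S"
  and shift_mult_left: "\<lbrakk>x \<in> carrier S; y \<in> carrier S\<rbrakk> \<Longrightarrow> A x \<otimes> y = A (x \<otimes> y)"
  and shift_mult_right: "\<lbrakk>x \<in> carrier S; y \<in> carrier S\<rbrakk> \<Longrightarrow> x \<otimes> A y = A (x \<otimes> y)"
  using translation unfolding translation_def by (blast, metis+)

lemma funpow_shift_closed [simp]: "x \<in> carrier S \<Longrightarrow> (A ^^ n) x \<in> carrier S"
  by (induction n) auto

lemma degree_funpow_shift: "x \<in> carrier S \<Longrightarrow> g ((A ^^ n) x) = g x + n"
  by (induction n) (auto simp: degree_shift)

lemma funpow_shift_inj: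
  "\<lbrakk>x \<in> carrier S; y \<in> carrier S; (A ^^ n) x = (A ^^ n) y\<rbrakk> \<Longrightarrow> x = y"
  by (induction n) (auto dest: inj_onD[OF inj])

lemma funpow_shift_mult_left:
  "\<lbrakk>x \<in> carrier S; y \<in> carrier S\<rbrakk> \<Longrightarrow> (A ^^ n) x \<otimes> y = (A ^^ n) (x \<otimes> y)"
  by (induction n) (auto simp: shift_mult_left)

lemma funpow_shift_mult:
  "\<lbrakk>x \<in> carrier S; y \<in> carrier S\<rbrakk>
    \<Longrightarrow> (A ^^ m) x \<otimes> (A ^^ n) y = (A ^^ (m + n)) (x \<otimes> y)"
proof (induction n)
  case 0
  then show ?case by (simp add: funpow_shift_mult_left)
next
  case (Suc n)
  then show ?case by (simp add: shift_mult_right)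
qed

lemma ex_funpow_shift_degree_zero:
  "x \<in> carrier S \<Longrightarrow> \<exists>n. \<exists>z\<in>carrier S. g z = 0 \<and> x = (A ^^ n) z"
proof (induction "g x" arbitrary: x)
  case 0
  then show ?case by (intro exI[of _ 0]) auto
next
  case (Suc d)
  then obtain y where y: "y \<in> carrier S" "x = A y"
    using shift_onto[of x] by auto
  with Suc have "d = g y" by (simp add: degree_shift)
  with Suc y obtain n z where "z \<in> carrier S" "g z = 0" "y = (A ^^ n) z" by blast
  with y show ?case by (intro exI[of _ "Suc n"] bexI[of _ z]) auto
qed

lemma degree_zero_nonempty: "carrier (degree_zero S g) \<noteq> {}"
  using nonempty ex_funpow_shift_degree_zero by (fastforce simp: degree_zero_def)

text \<open>The isomorphism is the inverse of \<open>(n, z) \<mapsto> A\<^sup>n z\<close>.\<close>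

lemma iso_nat_times_degree_zero: "S \<cong> nat_add \<times>\<times> degree_zero S g"
proof -
  let ?D = "carrier (nat_add \<times>\<times> degree_zero S g)"
  let ?join = "\<lambda>(n, z). (A ^^ n) z"
  define split where "split = the_inv_into ?D ?join"
  have D: "?D = UNIV \<times> {z \<in> carrier S. g z = 0}"
    by (simp add: nat_add_def degree_zero_def)
  have "inj_on ?join ?D"
  proof (rule inj_onI)
    fix p q assume pq: "p \<in> ?D" "q \<in> ?D" "?join p = ?join q"
    obtain m x n y where mn: "p = (m, x)" "q = (n, y)" by (cases p, cases q)
    with pq(1,2) have p: "x \<in> carrier S" "g x = 0" and q: "y \<in> carrier S" "g y = 0"
      unfolding D by auto
    from pq(3) mn have eq: "(A ^^ m) x = (A ^^ n) y" by simp
    have "m = n"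
      using arg_cong[OF eq, of g] p q by (simp add: degree_funpow_shift)
    with eq p q mn show "p = q" using funpow_shift_inj by auto
  qed
  moreover have "?join ` ?D = carrier S"
    unfolding D using ex_funpow_shift_degree_zero by fastforce
  ultimately have bij: "bij_betw ?join ?D (carrier S)"
    by (simp add: bij_betw_def)
  have join_mult: "?join (p \<otimes>\<^bsub>nat_add \<times>\<times> degree_zero S g\<^esub> q) = ?join p \<otimes> ?join q"
    if "p \<in> ?D" "q \<in> ?D" for p q
    using that by (auto simp: D nat_add_def degree_zero_def mult_DirProd' funpow_shift_mult
      split: prod.splits)
  have D_closed: "p \<otimes>\<^bsub>nat_add \<times>\<times> degree_zero S g\<^esub> q \<in> ?D" if "p \<in> ?D" "q \<in> ?D" for p q
    using that degree_hom closed
    by (auto simp: D nat_add_def degree_zero_def mult_DirProd' hom_def)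
  have split_join: "split (?join p) = p" if "p \<in> ?D" for p
    unfolding split_def using bij that by (intro the_inv_into_f_f) (auto simp: bij_betw_def)
  have bij': "bij_betw split (carrier S) ?D"
    unfolding split_def using bij by (rule bij_betw_the_inv_into)
  have "split (x \<otimes> y) = split x \<otimes>\<^bsub>nat_add \<times>\<times> degree_zero S g\<^esub> split y"
    if "x \<in> carrier S" "y \<in> carrier S" for x y
  proof -
    from that bij obtain p q where p: "p \<in> ?D" "x = ?join p" and q: "q \<in> ?D" "y = ?join q"
      unfolding bij_betw_def by blast
    then show ?thesis
      using join_mult[OF p(1) q(1)] split_join D_closed by metis
  qed
  then have "split \<in> iso S (nat_add \<times>\<times> degree_zero S g)"
    using bij' by (auto simp: iso_def hom_def bij_betw_def)
  then show ?thesis by (auto simp: is_iso_def)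
qed

end

lemma semigp_iso_sym:
  assumes "semigp G" and "G \<cong> H"
  shows "H \<cong> G"
proof -
  interpret semigp G by fact
  from assms obtain \<phi> where \<phi>: "\<phi> \<in> hom G H" "bij_betw \<phi> (carrier G) (carrier H)"
    by (auto simp: is_iso_def iso_def)
  let ?\<psi> = "the_inv_into (carrier G) \<phi>"
  have bij: "bij_betw ?\<psi> (carrier H) (carrier G)"
    using \<phi>(2) by (rule bij_betw_the_inv_into)
  have inj: "inj_on \<phi> (carrier G)" using \<phi>(2) by (simp add: bij_betw_def)
  have "?\<psi> (u \<otimes>\<^bsub>H\<^esub> v) = ?\<psi> u \<otimes>\<^bsub>G\<^esub> ?\<psi> v" if "u \<in> carrier H" "v \<in> carrier H" for u v
  proof -
    from that \<phi>(2) obtain x y where "x \<in> carrier G" "u = \<phi> x" "y \<in> carrier G" "v = \<phi> y"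
      unfolding bij_betw_def by blast
    then show ?thesis
      using \<phi>(1) inj closed by (simp add: hom_mult[symmetric] the_inv_into_f_f)
  qed
  with bij have "?\<psi> \<in> iso H G" by (auto simp: iso_def hom_def bij_betw_def)
  then show ?thesis by (auto simp: is_iso_def)
qed

text \<open>The projection and the shift of \<open>\<nat> \<times> Z\<close>, transported to \<open>S\<close>.\<close>

lemma semigp_nat_shift_if_iso:
  assumes S: "semigp S" and iso: "S \<cong> nat_add \<times>\<times> Z"
  obtains g A where "nat_shift S g A"
proof -
  interpret semigp S by fact
  let ?P = "nat_add \<times>\<times> Z"
  from iso obtain \<phi> where hom: "\<phi> \<in> hom S ?P" and bij: "bij_betw \<phi> (carrier S) (carrier ?P)"
    by (auto simp: is_iso_def iso_def)
  define \<psi> where "\<psi> = the_inv_into (carrier S) \<phi>"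
  have inj: "inj_on \<phi> (carrier S)" using bij by (simp add: bij_betw_def)
  have P: "carrier ?P = UNIV \<times> carrier Z" by (simp add: nat_add_def)
  have \<psi>_closed: "\<psi> p \<in> carrier S" if "p \<in> carrier ?P" for p
    using bij_betw_the_inv_into[OF bij] that unfolding \<psi>_def bij_betw_def by blast
  have \<phi>\<psi>: "\<phi> (\<psi> p) = p" if "p \<in> carrier ?P" for p
    unfolding \<psi>_def using bij that by (intro f_the_inv_into_f) (auto simp: bij_betw_def)
  have \<phi>_closed: "snd (\<phi> x) \<in> carrier Z" if "x \<in> carrier S" for x
    using hom_in_carrier[OF hom that] P by (auto simp: mem_Times_iff)
  have \<phi>_mult: "\<phi> (x \<otimes>\<^bsub>S\<^esub> y) = (fst (\<phi> x) + fst (\<phi> y), snd (\<phi> x) \<otimes>\<^bsub>Z\<^esub> snd (\<phi> y))"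
    if "x \<in> carrier S" "y \<in> carrier S" for x y
    using hom_mult[OF hom that] by (simp add: mult_DirProd' nat_add_def)
  define g where "g = (\<lambda>x. fst (\<phi> x))"
  define A where "A = (\<lambda>x. \<psi> (Suc (fst (\<phi> x)), snd (\<phi> x)))"
  have A_closed: "A x \<in> carrier S" if "x \<in> carrier S" for x
    unfolding A_def using that \<phi>_closed by (intro \<psi>_closed) (simp add: nat_add_def)
  have \<phi>A: "\<phi> (A x) = (Suc (fst (\<phi> x)), snd (\<phi> x))" if "x \<in> carrier S" for x
    unfolding A_def using that \<phi>_closed by (intro \<phi>\<psi>) (simp add: nat_add_def)
  have "nat_shift S g A"
  proof
    show "g \<in> hom S nat_add" by (simp add: hom_nat_add_iff g_def \<phi>_mult)
    show "translation S A"
      unfolding translation_def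
      by (auto intro!: inj_onD[OF inj] A_closed closed simp: \<phi>A \<phi>_mult A_closed closed)
    show "inj_on A (carrier S)"
    proof (rule inj_onI)
      fix x y assume xy: "x \<in> carrier S" "y \<in> carrier S" "A x = A y"
      then have "\<phi> x = \<phi> y" using \<phi>A by (metis Pair_inject nat.inject prod_eqI)
      with xy show "x = y" by (auto dest: inj_onD[OF inj])
    qed
    show "g (A x) = g x + 1" if "x \<in> carrier S" for x
      using that by (simp add: g_def \<phi>A)
    show "x \<in> A ` carrier S" if x: "x \<in> carrier S" "g x > 0" for x
    proof
      let ?p = "(fst (\<phi> x) - 1, snd (\<phi> x))"
      have p: "?p \<in> carrier ?P" using x \<phi>_closed by (simp add: nat_add_def)
      show "\<psi> ?p \<in> carrier S" using p by (rule \<psi>_closed)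
      show "x = A (\<psi> ?p)"
        using x p by (intro inj_onD[OF inj]) (auto simp: \<phi>A \<phi>\<psi> \<psi>_closed A_closed g_def)
    qed
  qed
  with that show thesis .
qed

section \<open>Homomorphisms and translations on a direct product\<close>

text \<open>
  A negative value \<open>g x\<close> would make the values \<open>n * g x\<close> at the powers of \<open>x\<close> unbounded below.
\<close>

lemma (in semigp) additive_int_nonneg_if_bounded_below:
  fixes g :: "'a \<Rightarrow> int"
  assumes add: "\<And>x y. \<lbrakk>x \<in> carrier G; y \<in> carrier G\<rbrakk> \<Longrightarrow> g (x \<otimes> y) = g x + g y"
    and bound: "\<And>x. x \<in> carrier G \<Longrightarrow> K \<le> g x"
    and x: "x \<in> carrier G"
  shows "g x \<ge> 0"
proof (rule ccontr)
  assume neg: "\<not> g x \<ge> 0"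
  have "\<exists>y\<in>carrier G. g y = int (Suc n) * g x" for n
  proof (induction n)
    case 0
    then show ?case using x by auto
  next
    case (Suc n)
    then obtain y where "y \<in> carrier G" "g y = int (Suc n) * g x" by blast
    then show ?case
      using x by (intro bexI[of _ "y \<otimes> x"]) (auto simp: add closed algebra_simps)
  qed
  then obtain y where y: "y \<in> carrier G" "g y = int (Suc (nat \<bar>K\<bar>)) * g x" by blast
  have "int (Suc (nat \<bar>K\<bar>)) * g x \<le> int (Suc (nat \<bar>K\<bar>)) * (-1)"
    using neg by (intro mult_left_mono) auto
  then have "g y < K" using y by simp
  with bound[OF y(1)] show False by simp
qed

text \<open>
  Evaluating \<open>f\<close> at \<open>(x x' u, y w v)\<close> in two ways gives
  \<open>f (x x', y) + f (u, w v) = f (x, y) + f (x', w) + f (u, v)\<close>, so that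
  \<open>f (x x', y) - f (x, y)\<close> does not depend on \<open>y\<close>. Multiplying by \<open>(u, v)\<close> on the left instead, one
  sees that \<open>f (x x', y) - f (x', y)\<close> does not depend on \<open>y\<close> either. Therefore passing from \<open>y\<close> to
  \<open>y'\<close> changes \<open>f (x, y)\<close> and \<open>f (x', y)\<close> by the same amount. So \<open>f\<close> is a sum of a function of
  \<open>x\<close> and a function of \<open>y\<close> with integer values, each of them additive up to a constant. Moving
  that constant from one summand to the other makes both additive, and boundedness below makes
  them nonnegative.
\<close>

lemma hom_to_nat_splits:
  assumes S: "semigp S" and T: "semigp T" and f: "f \<in> hom (S \<times>\<times> T) nat_add"
  obtains g h where "g \<in> hom S nat_add" and "h \<in> hom T nat_add"
    and "\<And>x y. \<lbrakk>x \<in> carrier S; y \<in> carrier T\<rbrakk> \<Longrightarrow> f (x, y) = g x + h y"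
proof -
  interpret S: semigp S by fact
  interpret T: semigp T by fact
  obtain a b where ab: "a \<in> carrier S" "b \<in> carrier T"
    using S.nonempty T.nonempty by blast
  have f_mult: "f (x \<otimes>\<^bsub>S\<^esub> x', y \<otimes>\<^bsub>T\<^esub> y') = f (x, y) + f (x', y')"
    if "x \<in> carrier S" "x' \<in> carrier S" "y \<in> carrier T" "y' \<in> carrier T" for x x' y y'
    using f that by (auto simp: hom_nat_add_iff)
  have exchange: "f (x, y) + f (x', y') = f (x, y') + f (x', y)"
    if xy: "x \<in> carrier S" "x' \<in> carrier S" "y \<in> carrier T" "y' \<in> carrier T" for x x' y y'
  proof -
    have right: "f (x \<otimes>\<^bsub>S\<^esub> x', z) + f (x, y \<otimes>\<^bsub>T\<^esub> y) = f (x, z) + f (x', y) + f (x, y)"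
      if "z \<in> carrier T" for z
      using f_mult[of "x \<otimes>\<^bsub>S\<^esub> x'" x z "y \<otimes>\<^bsub>T\<^esub> y"] f_mult[of x "x' \<otimes>\<^bsub>S\<^esub> x" z "y \<otimes>\<^bsub>T\<^esub> y"]
        f_mult[of x' x y y] xy that
      by (simp add: S.closed T.closed S.assoc)
    have left: "f (x, y \<otimes>\<^bsub>T\<^esub> y) + f (x \<otimes>\<^bsub>S\<^esub> x', z) = f (x, y) + f (x, y) + f (x', z)"
      if "z \<in> carrier T" for z
      using f_mult[of x "x \<otimes>\<^bsub>S\<^esub> x'" "y \<otimes>\<^bsub>T\<^esub> y" z] f_mult[of "x \<otimes>\<^bsub>S\<^esub> x" x' "y \<otimes>\<^bsub>T\<^esub> y" z]
        f_mult[of x x y y] xy that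
      by (simp add: S.closed T.closed S.assoc)
    show ?thesis
      using right[OF xy(3)] right[OF xy(4)] left[OF xy(3)] left[OF xy(4)] by linarith
  qed
  \<comment> \<open>By the exchange rule, \<open>K\<close> is the amount by which \<open>f (x x', b)\<close> exceeds
    \<open>f (x, b) + f (x', b)\<close>, for any \<open>x\<close> and \<open>x'\<close>.\<close>
  define K where "K = int (f (a \<otimes>\<^bsub>S\<^esub> a, b)) - 2 * int (f (a, b))"
  define g where "g = (\<lambda>x. int (f (x, b)) + K)"
  define h where "h = (\<lambda>y. int (f (a, y)) - int (f (a, b)) - K)"
  have f_split: "int (f (x, y)) = g x + h y" if "x \<in> carrier S" "y \<in> carrier T" for x y
    using exchange[of x a y b] that ab by (simp add: g_def h_def)
  have g_add: "g (x \<otimes>\<^bsub>S\<^esub> x') = g x + g x'" if "x \<in> carrier S" "x' \<in> carrier S" for x x'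
    using that ab exchange[of "x \<otimes>\<^bsub>S\<^esub> x'" "a \<otimes>\<^bsub>S\<^esub> a" b "b \<otimes>\<^bsub>T\<^esub> b"]
    by (simp add: g_def K_def f_mult S.closed T.closed)
  have h_add: "h (y \<otimes>\<^bsub>T\<^esub> y') = h y + h y'" if "y \<in> carrier T" "y' \<in> carrier T" for y y'
    using that ab f_mult[of a a y y'] f_split[of a y] f_split[of a y']
      f_split[of "a \<otimes>\<^bsub>S\<^esub> a" "y \<otimes>\<^bsub>T\<^esub> y'"]
    by (simp add: g_add S.closed T.closed)
  have g_nonneg: "g x \<ge> 0" if "x \<in> carrier S" for x
    using that by (intro S.additive_int_nonneg_if_bounded_below[where K = K])
      (auto simp: g_add, auto simp: g_def)
  have h_nonneg: "h y \<ge> 0" if "y \<in> carrier T" for y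
    using that
    by (intro T.additive_int_nonneg_if_bounded_below[where K = "- int (f (a, b)) - K"])
      (auto simp: h_add, auto simp: h_def)
  show thesis
  proof
    show "nat \<circ> g \<in> hom S nat_add"
      by (simp add: hom_nat_add_iff g_add g_nonneg nat_add_distrib)
    show "nat \<circ> h \<in> hom T nat_add"
      by (simp add: hom_nat_add_iff h_add h_nonneg nat_add_distrib)
    show "f (x, y) = (nat \<circ> g) x + (nat \<circ> h) y" if "x \<in> carrier S" "y \<in> carrier T" for x y
      using f_split[OF that] g_nonneg[OF that(1)] h_nonneg[OF that(2)] by simp
  qed
qed

text \<open>
  The translation can be moved to either factor of \<open>(x x', y y') = (x, y) (x', y')\<close>. Hence
  the first coordinate of its value is that of \<open>A (x, y)\<close> times \<open>x'\<close>, which does not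
  involve \<open>y'\<close>, and also \<open>x\<close> times that of \<open>A (x', y')\<close>, which does not involve \<open>y\<close>. As every
  element of \<open>T\<close> has the form \<open>y y'\<close>, the first coordinate depends on the first argument only.
\<close>

lemma translation_fst_indep:
  assumes S: "semigp_of_products S" and T: "semigp_of_products T"
    and A: "translation (S \<times>\<times> T) A"
    and x: "x \<in> carrier S" and y: "y \<in> carrier T" and w: "w \<in> carrier T"
  shows "fst (A (x, y)) = fst (A (x, w))"
proof -
  interpret S: semigp_of_products S by fact
  interpret T: semigp_of_products T by fact
  obtain x1 x2 where x12: "x1 \<in> carrier S" "x2 \<in> carrier S" "x = x1 \<otimes>\<^bsub>S\<^esub> x2"
    using S.factors[OF x] by blast
  obtain y1 y2 where y12: "y1 \<in> carrier T" "y2 \<in> carrier T" "y = y1 \<otimes>\<^bsub>T\<^esub> y2"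
    using T.factors[OF y] by blast
  obtain w1 w2 where w12: "w1 \<in> carrier T" "w2 \<in> carrier T" "w = w1 \<otimes>\<^bsub>T\<^esub> w2"
    using T.factors[OF w] by blast
  have left: "fst (A (x, u \<otimes>\<^bsub>T\<^esub> v)) = fst (A (x1, u)) \<otimes>\<^bsub>S\<^esub> x2"
    and right: "fst (A (x, u \<otimes>\<^bsub>T\<^esub> v)) = x1 \<otimes>\<^bsub>S\<^esub> fst (A (x2, v))"
    if "u \<in> carrier T" "v \<in> carrier T" for u v
  proof -
    have mem: "(x1, u) \<in> carrier (S \<times>\<times> T)" "(x2, v) \<in> carrier (S \<times>\<times> T)"
      using that x12 by auto
    have eq: "(x1, u) \<otimes>\<^bsub>S \<times>\<times> T\<^esub> (x2, v) = (x, u \<otimes>\<^bsub>T\<^esub> v)" using x12 by simp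
    from A mem have "A (x, u \<otimes>\<^bsub>T\<^esub> v) = A (x1, u) \<otimes>\<^bsub>S \<times>\<times> T\<^esub> (x2, v)"
      "A (x, u \<otimes>\<^bsub>T\<^esub> v) = (x1, u) \<otimes>\<^bsub>S \<times>\<times> T\<^esub> A (x2, v)"
      unfolding translation_def eq[symmetric] by blast+
    then show "fst (A (x, u \<otimes>\<^bsub>T\<^esub> v)) = fst (A (x1, u)) \<otimes>\<^bsub>S\<^esub> x2"
      "fst (A (x, u \<otimes>\<^bsub>T\<^esub> v)) = x1 \<otimes>\<^bsub>S\<^esub> fst (A (x2, v))"
      by (simp_all add: mult_DirProd')
  qed
  \<comment> \<open>Exchange the two factors of \<open>y\<close> for those of \<open>w\<close> one at a time.\<close>
  have "fst (A (x, y)) = fst (A (x, y1 \<otimes>\<^bsub>T\<^esub> w2))"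
    using left y12 w12 by simp
  also have "\<dots> = fst (A (x, w))"
    using right y12 w12 by simp
  finally show ?thesis .
qed

lemma translation_swap:
  assumes "translation (S \<times>\<times> T) A"
  shows "translation (T \<times>\<times> S) (prod.swap \<circ> A \<circ> prod.swap)"
  using assms unfolding translation_def
  by (fastforce simp: mult_DirProd' Pi_iff prod.swap_def split: prod.splits)

lemma translation_splits:
  assumes S: "semigp_of_products S" and T: "semigp_of_products T"
    and A: "translation (S \<times>\<times> T) A"
  obtains B C where "translation S B" and "translation T C"
    and "\<And>x y. \<lbrakk>x \<in> carrier S; y \<in> carrier T\<rbrakk> \<Longrightarrow> A (x, y) = (B x, C y)"
proof -
  interpret S: semigp_of_products S by fact
  interpret T: semigp_of_products T by fact
  obtain a b where ab: "a \<in> carrier S" "b \<in> carrier T"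
    using S.nonempty T.nonempty by blast
  define B where "B = (\<lambda>x. fst (A (x, b)))"
  define C where "C = (\<lambda>y. snd (A (a, y)))"
  have A_split: "A (x, y) = (B x, C y)" if "x \<in> carrier S" "y \<in> carrier T" for x y
    using translation_fst_indep[OF S T A, of x y b] that ab
      translation_fst_indep[OF T S translation_swap[OF A], of y x a]
    by (auto simp: B_def C_def intro: prod_eqI)
  have A_mult: "A ((x, y) \<otimes>\<^bsub>S \<times>\<times> T\<^esub> (x', y')) = A (x, y) \<otimes>\<^bsub>S \<times>\<times> T\<^esub> (x', y')"
    "A ((x, y) \<otimes>\<^bsub>S \<times>\<times> T\<^esub> (x', y')) = (x, y) \<otimes>\<^bsub>S \<times>\<times> T\<^esub> A (x', y')"
    "A (x, y) \<in> carrier (S \<times>\<times> T)"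
    if "x \<in> carrier S" "x' \<in> carrier S" "y \<in> carrier T" "y' \<in> carrier T" for x x' y y'
  proof -
    from that have "(x, y) \<in> carrier (S \<times>\<times> T)" "(x', y') \<in> carrier (S \<times>\<times> T)" by auto
    with A show "A ((x, y) \<otimes>\<^bsub>S \<times>\<times> T\<^esub> (x', y')) = A (x, y) \<otimes>\<^bsub>S \<times>\<times> T\<^esub> (x', y')"
      "A ((x, y) \<otimes>\<^bsub>S \<times>\<times> T\<^esub> (x', y')) = (x, y) \<otimes>\<^bsub>S \<times>\<times> T\<^esub> A (x', y')"
      "A (x, y) \<in> carrier (S \<times>\<times> T)"
      unfolding translation_def by blast+
  qed
  show thesis
  proof
    show "translation S B"
      using A_mult[OF _ _ ab(2) ab(2)] ab
      by (auto simp: translation_def A_split S.closed T.closed)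
    show "translation T C"
      using A_mult[OF ab(1) ab(1)] ab
      by (auto simp: translation_def A_split S.closed T.closed)
  qed (rule A_split)
qed

section \<open>Primality\<close>

lemma semigp_DirProd: "semigp S \<Longrightarrow> semigp T \<Longrightarrow> semigp (S \<times>\<times> T)"
  by (auto simp: semigp_def)

lemma nat_shift_on_factor:
  assumes S: "semigp_of_products S" and T: "semigp_of_products T"
    and shift: "nat_shift (S \<times>\<times> T) f F"
  shows "(\<exists>g A. nat_shift S g A) \<or> (\<exists>g A. nat_shift T g A)"
proof -
  interpret S: semigp_of_products S by fact
  interpret T: semigp_of_products T by fact
  interpret nat_shift "S \<times>\<times> T" f F by fact
  obtain g h where g: "g \<in> hom S nat_add" and h: "h \<in> hom T nat_add"
    and f_split: "\<And>x y. \<lbrakk>x \<in> carrier S; y \<in> carrier T\<rbrakk> \<Longrightarrow> f (x, y) = g x + h y"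
    using hom_to_nat_splits[OF S.semigp_axioms T.semigp_axioms degree_hom] by blast
  obtain A B where A: "translation S A" and B: "translation T B"
    and F_split: "\<And>x y. \<lbrakk>x \<in> carrier S; y \<in> carrier T\<rbrakk> \<Longrightarrow> F (x, y) = (A x, B y)"
    using translation_splits[OF S T translation] by blast
  have A_closed: "A x \<in> carrier S" if "x \<in> carrier S" for x
    using A that by (auto simp: translation_def)
  have B_closed: "B y \<in> carrier T" if "y \<in> carrier T" for y
    using B that by (auto simp: translation_def)
  have raise: "g (A x) + h (B y) = g x + h y + 1" if "x \<in> carrier S" "y \<in> carrier T" for x y
    using degree_shift[of "(x, y)"] that by (simp add: f_split F_split A_closed B_closed)
  have preimage: "\<exists>x'\<in>carrier S. \<exists>y'\<in>carrier T. x = A x' \<and> y = B y'"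
    if "x \<in> carrier S" "y \<in> carrier T" "g x + h y > 0" for x y
    using shift_onto[of "(x, y)"] that by (auto simp: f_split F_split)
  have F_inj: "x = x' \<and> y = y'"
    if "x \<in> carrier S" "x' \<in> carrier S" "y \<in> carrier T" "y' \<in> carrier T"
      "A x = A x'" "B y = B y'" for x x' y y'
    using inj_onD[OF inj, of "(x, y)" "(x', y')"] that by (simp add: F_split)
  obtain a where a: "a \<in> carrier S" "\<And>x. x \<in> carrier S \<Longrightarrow> g a \<le> g x"
    using S.nonempty ex_has_least_nat[of "\<lambda>x. x \<in> carrier S" _ g] by blast
  obtain b where b: "b \<in> carrier T" "\<And>y. y \<in> carrier T \<Longrightarrow> h b \<le> h y"
    using T.nonempty ex_has_least_nat[of "\<lambda>y. y \<in> carrier T" _ h] by blast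
  \<comment> \<open>At the minima \<open>a\<close>, \<open>b\<close> neither degree decreases, so the total increase \<open>1\<close> occurs on one side
    only. The rule \<open>raise\<close> then carries this over from \<open>a\<close> or \<open>b\<close> to all elements.\<close>
  have "h (B b) = h b \<or> g (A a) = g a"
    using raise[OF a(1) b(1)] a(2)[OF A_closed[OF a(1)]] b(2)[OF B_closed[OF b(1)]] by linarith
  then show ?thesis
  proof
    assume hb: "h (B b) = h b"
    have "nat_shift S g A"
    proof
      show "inj_on A (carrier S)" using F_inj b(1) by (blast intro: inj_onI)
      show "g (A x) = g x + 1" if "x \<in> carrier S" for x
        using raise[OF that b(1)] hb by simp
      show "x \<in> A ` carrier S" if "x \<in> carrier S" "g x > 0" for x
        using preimage[OF that(1) b(1)] that by auto
    qed (fact g A)+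
    then show ?thesis by blast
  next
    assume ga: "g (A a) = g a"
    have "nat_shift T h B"
    proof
      show "inj_on B (carrier T)" using F_inj a(1) by (blast intro: inj_onI)
      show "h (B y) = h y + 1" if "y \<in> carrier T" for y
        using raise[OF a(1) that] ga by simp
      show "y \<in> B ` carrier T" if "y \<in> carrier T" "h y > 0" for y
        using preimage[OF a(1) that(1)] that by auto
    qed (fact h B)+
    then show ?thesis by blast
  qed
qed

text \<open>
  The complement of \<open>\<nat>\<close> in a factor is the part of degree \<open>0\<close> for some homomorphism to \<open>\<nat>\<close>, so
  closure of \<open>C\<close> under taking such parts keeps the complement in the subcategory.
\<close>

lemma prime_in_nat_addI:
  fixes C :: "'u monoid \<Rightarrow> bool"
  assumes C_products: "\<And>S. C S \<Longrightarrow> semigp_of_products S"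
    and C_degree_zero: "\<And>S g. \<lbrakk>C S; g \<in> hom S nat_add; carrier (degree_zero S g) \<noteq> {}\<rbrakk>
      \<Longrightarrow> C (degree_zero S g)"
  shows "prime_in C nat_add"
  unfolding prime_in_def
proof (intro conjI allI impI; (elim conjE)?)
  show "\<not> (\<exists>e. carrier nat_add = {e})"
    by (auto simp: nat_add_def) (metis UNIV_I singletonD zero_neq_one)
next
  fix Y Y0 Y1 :: "'u monoid"
  assume C: "C Y" "C Y0" "C Y1" and factor: "direct_factor C nat_add Y" and iso: "Y \<cong> Y0 \<times>\<times> Y1"
  have Y: "semigp Y" using C_products[OF C(1)] by (simp add: semigp_of_products_def)
  have P: "semigp (Y0 \<times>\<times> Y1)"
    using C_products[OF C(2)] C_products[OF C(3)]
    by (intro semigp_DirProd) (simp_all add: semigp_of_products_def)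
  from factor obtain Z :: "'u monoid" where "Y \<cong> nat_add \<times>\<times> Z"
    unfolding direct_factor_def by blast
  with semigp_iso_sym[OF Y iso] have "Y0 \<times>\<times> Y1 \<cong> nat_add \<times>\<times> Z"
    by (auto simp: is_iso_def dest: iso_set_trans)
  then obtain f F where "nat_shift (Y0 \<times>\<times> Y1) f F"
    using semigp_nat_shift_if_iso[OF P] by blast
  then have shift: "(\<exists>g A. nat_shift Y0 g A) \<or> (\<exists>g A. nat_shift Y1 g A)"
    using nat_shift_on_factor C_products C by blast
  have direct_factor: "direct_factor C nat_add S" if "C S" "nat_shift S g A" for S g A
    unfolding direct_factor_def
    using nat_shift.iso_nat_times_degree_zero[OF that(2)] nat_shift.degree_hom[OF that(2)]
      nat_shift.degree_zero_nonempty[OF that(2)] C_degree_zero[OF that(1)] by blast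
  with shift C show "direct_factor C nat_add Y0 \<or> direct_factor C nat_add Y1" by blast
qed

lemma monoid_imp_semigp_of_products:
  assumes "monoid S"
  shows "semigp_of_products S"
proof -
  interpret monoid S by fact
  show ?thesis
  proof
    show "carrier S \<noteq> {}" using one_closed by blast
    show "\<exists>y\<in>carrier S. \<exists>z\<in>carrier S. x = y \<otimes>\<^bsub>S\<^esub> z" if "x \<in> carrier S" for x
      using that by (intro bexI[of _ x] bexI[of _ "\<one>\<^bsub>S\<^esub>"]) auto
  qed (auto simp: m_assoc)
qed

lemma monoid_degree_zero:
  assumes "monoid S" and g: "g \<in> hom S nat_add"
  shows "monoid (degree_zero S g)"
proof -
  interpret monoid S by fact
  have "g (\<one>\<^bsub>S\<^esub> \<otimes>\<^bsub>S\<^esub> \<one>\<^bsub>S\<^esub>) = g \<one>\<^bsub>S\<^esub> + g \<one>\<^bsub>S\<^esub>"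
    using g one_closed unfolding hom_nat_add_iff by blast
  then have "g \<one>\<^bsub>S\<^esub> = 0" by simp
  with g show ?thesis
    by unfold_locales (auto simp: degree_zero_def hom_nat_add_iff m_assoc)
qed

lemma semigp_of_products_degree_zero:
  assumes "semigp_of_products S" and g: "g \<in> hom S nat_add"
    and nonempty: "carrier (degree_zero S g) \<noteq> {}"
  shows "semigp_of_products (degree_zero S g)"
proof -
  interpret semigp_of_products S by fact
  show ?thesis
  proof
    show "carrier (degree_zero S g) \<noteq> {}" by fact
  next
    fix x assume x: "x \<in> carrier (degree_zero S g)"
    then obtain y z where yz: "y \<in> carrier S" "z \<in> carrier S" "x = y \<otimes>\<^bsub>S\<^esub> z"
      using factors[of x] by (auto simp: degree_zero_def)
    moreover from x yz g have "g y = 0" "g z = 0"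
      by (auto simp: degree_zero_def hom_nat_add_iff)
    ultimately show "\<exists>y\<in>carrier (degree_zero S g). \<exists>z\<in>carrier (degree_zero S g).
        x = y \<otimes>\<^bsub>degree_zero S g\<^esub> z"
      by (intro bexI[of _ y] bexI[of _ z]) (auto simp: degree_zero_def)
  qed (use g in \<open>auto simp: degree_zero_def hom_nat_add_iff closed assoc\<close>)
qed

lemma monoid_nat_add: "monoid nat_add"
  by unfold_locales (auto simp: nat_add_def)

theorem theorem4p4:
  shows "(monoid nat_add \<and> prime_in (monoid :: 'u monoid \<Rightarrow> bool) nat_add) \<and>
    (semigp_of_products nat_add \<and>
      prime_in (semigp_of_products :: 'u monoid \<Rightarrow> bool) nat_add)"
proof (intro conjI)
  show "monoid nat_add" by (rule monoid_nat_add)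
  then show "semigp_of_products nat_add" by (rule monoid_imp_semigp_of_products)
  show "prime_in (monoid :: 'u monoid \<Rightarrow> bool) nat_add"
    by (rule prime_in_nat_addI) (rule monoid_imp_semigp_of_products monoid_degree_zero; assumption)+
  show "prime_in (semigp_of_products :: 'u monoid \<Rightarrow> bool) nat_add"
    by (rule prime_in_nat_addI) (assumption | rule semigp_of_products_degree_zero)+
qed

end
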